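(* Let $d\ge2$, $n,n'\le d$, and let $$\hat\rho_{12}=\sum_{l=1}^{n}p_l\,|\psi^{(l)}\rangle_{12}\langle\psi^{(l)}|,\qquad \hat\rho_{34}=\sum_{l'=1}^{n'}q_{l'}\,|\chi^{(l')}\rangle_{34}\langle\chi^{(l')}|$$ be bipartite $d\times d$ density matrices, where $(p_l)$ and $(q_{l'})$ are probability distributions and $$|\psi^{(l)}\rangle_{12}=\sum_{k=0}^{d-1}a_k^{(l)}|kk\rangle_{12},\qquad |\chi^{(l')}\rangle_{34}=\sum_{k'=0}^{d-1}b_{k'}^{(l')}|k'k'\rangle_{34}$$ are normalized pure states with $a_k^{(l)},b_{k'}^{(l')}\in\mathbb{C}$ and with orthonormal basis states $|k\rangle_i$ of the $d$-dimensional system $i\in\{1,2,3,4\}$ independent of $l$ and $l'$. Let $\theta_{mm'}\in\mathbb{R}$ ($m,m'=0,\dots,d-1$) be arbitrary. For $j,j'\in\{0,\dots,d-1\}$ set $$|P^{(j,j')}\rangle_{23}=\frac1d\sum_{m,m'=0}^{d-1}e^{i\left[\frac{2\pi}{d^2}(dj+j')(dm+m')+\theta_{mm'}\right]}|mm'\rangle_{23},$$ $$\hat U_b^{(j,j')}|m'\rangle_4=e^{i\frac{2\pi}{d^2}(dj+j')m'}|m'\rangle_4,\qquad \hat U_a^{(j')}|m\rangle_1=e^{i\frac{2\pi}{d}j'm}|m\rangle_1.$$ Suppose Sapna (holding systems $2,3$) performs on $\hat\rho_{12}\otimes\hat\rho_{34}$ the projective measurement $\{|P^{(j,j')}\rangle_{23}\langle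 P^{(j,j')}|\}_{j,j'}$, and upon outcome $(j,j')$ Alice applies the unitary $\hat U_a^{(j')}$ to system $1$ and Bob applies the unitary $\hat U_b^{(j,j')}$ to system $4$. Then for every outcome $(j,j')$ the resulting state shared by Alice and Bob is $$\hat\sigma_{14}=\sum_{l=1}^{n}\sum_{l'=1}^{n'}p_lq_{l'}\,|\phi^{(ll')}\rangle_{14}\langle\phi^{(ll')}|,\qquad |\phi^{(ll')}\rangle_{14}=\sum_{k=0}^{d-1}\sum_{k'=0}^{d-1}a_k^{(l)}b_{k'}^{(l')}e^{-i\theta_{kk'}}|kk'\rangle_{14},$$ independent of $(j,j')$.
   Context: Alice holds system $1$, Bob holds system $4$, Sapna holds systems $2$ and $3$. Notation: $|mm'\rangle_{ab}=|m\rangle_a\otimes|m'\rangle_b$. The $d^2$ vectors $|P^{(j,j')}\rangle_{23}$ form an orthonormal basis of the Hilbert space of systems $2,3$, so the measurement is a von Neumann measurement. The state shared by Alice and Bob given outcome $(j,j')$ is the normalized post-measurement state reduced to systems $1,4$ by partial trace over systems $2,3$. *)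

theory Defs
  imports "HOL-Analysis.Analysis"
begin

text \<open>A \<open>d\<close>-dimensional system has state space \<^typ>\<open>complex^'d\<close> with \<open>d = CARD('d)\<close>. A composite
  system is indexed by the product of the index types of its parts; the four systems are grouped
  as \<open>(1,2),(3,4)\<close>. The norm of \<^typ>\<open>complex^'d\<close> is the Hilbert space norm.\<close>

definition cinner :: "complex^'n \<Rightarrow> complex^'n \<Rightarrow> complex" where
  "cinner x y = (\<Sum>i\<in>UNIV. cnj (x $ i) * y $ i)"

definition is_onb :: "'i set \<Rightarrow> ('i \<Rightarrow> complex^'n) \<Rightarrow> bool" where
  "is_onb I e \<longleftrightarrow>
     (\<forall>i\<in>I. \<forall>j\<in>I. cinner (e i) (e j) = (if i = j then 1 else 0)) \<and> vec.span (e ` I) = UNIV"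

definition ketbra :: "complex^'m \<Rightarrow> complex^'n \<Rightarrow> complex^'n^'m" where
  "ketbra x y = (\<chi> i j. x $ i * cnj (y $ j))"

definition dagger :: "complex^'n^'m \<Rightarrow> complex^'m^'n" where
  "dagger A = (\<chi> i j. cnj (A $ j $ i))"

definition tensor_vec :: "complex^'m \<Rightarrow> complex^'n \<Rightarrow> complex^('m \<times> 'n)"
    (infixr \<open>\<otimes>\<^sub>v\<close> 72) where
  "x \<otimes>\<^sub>v y = (\<chi> i. x $ fst i * y $ snd i)"

definition tensor_mat ::
    "complex^'m^'m \<Rightarrow> complex^'n^'n \<Rightarrow> complex^('m \<times> 'n)^('m \<times> 'n)"
    (infixr \<open>\<otimes>\<^sub>m\<close> 72) where
  "A \<otimes>\<^sub>m B = (\<chi> i j. A $ fst i $ fst j * B $ snd i $ snd j)"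

text \<open>The operator \<open>1 \<otimes> A \<otimes> 1\<close> with \<open>A\<close> acting on systems 2 and 3.\<close>

definition on_23 ::
    "complex^('b::finite \<times> 'c::finite)^('b \<times> 'c)
     \<Rightarrow> complex^(('a::finite \<times> 'b) \<times> ('c \<times> 'd::finite))^(('a \<times> 'b) \<times> ('c \<times> 'd))" where
  "on_23 A = (\<chi> r s. case (r, s) of (((i1, i2), (i3, i4)), ((j1, j2), (j3, j4))) \<Rightarrow>
     (if i1 = j1 \<and> i4 = j4 then A $ (i2, i3) $ (j2, j3) else 0))"

definition ptrace_23 ::
    "complex^(('a::finite \<times> 'b::finite) \<times> ('c::finite \<times> 'd::finite))^(('a \<times> 'b) \<times> ('c \<times> 'd))
     \<Rightarrow> complex^('a \<times> 'd)^('a \<times> 'd)" where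
  "ptrace_23 M = (\<chi> r s. case (r, s) of ((i1, i4), (j1, j4)) \<Rightarrow>
     (\<Sum>k2\<in>UNIV. \<Sum>k3\<in>UNIV. M $ ((i1, k2), (k3, i4)) $ ((j1, k2), (k3, j4))))"

text \<open>For \<open>trace M = 0\<close> (an outcome of probability zero) the value is the zero matrix.\<close>

definition normalize_state :: "complex^'n^'n \<Rightarrow> complex^'n^'n" where
  "normalize_state M = (\<chi> i j. M $ i $ j / trace M)"

definition post_measurement ::
    "complex^('b::finite \<times> 'c::finite)
     \<Rightarrow> complex^(('a::finite \<times> 'b) \<times> ('c \<times> 'd::finite))^(('a \<times> 'b) \<times> ('c \<times> 'd))
     \<Rightarrow> complex^(('a \<times> 'b) \<times> ('c \<times> 'd))^(('a \<times> 'b) \<times> ('c \<times> 'd))" where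
  "post_measurement P \<rho> =
     normalize_state (on_23 (ketbra P P) ** \<rho> ** dagger (on_23 (ketbra P P)))"

definition apply_unitary :: "complex^'n^'n \<Rightarrow> complex^'n^'n \<Rightarrow> complex^'n^'n" where
  "apply_unitary U \<rho> = U ** \<rho> ** dagger U"

definition measurement_ket ::
    "(nat \<Rightarrow> complex^'d) \<Rightarrow> (nat \<Rightarrow> complex^'d) \<Rightarrow> (nat \<Rightarrow> nat \<Rightarrow> real)
     \<Rightarrow> nat \<Rightarrow> nat \<Rightarrow> complex^('d \<times> 'd)" where
  "measurement_ket e f \<theta> j j' =
     (let d = CARD('d) in
      (1 / of_nat d) *s
      (\<Sum>m<d. \<Sum>m'<d.
         cis (2 * pi / real (d\<^sup>2) * real (d * j + j') * real (d * m + m') + \<theta> m m')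
           *s (e m \<otimes>\<^sub>v f m')))"

lemma cinner_sum_right: "cinner x (\<Sum>i\<in>I. f i) = (\<Sum>i\<in>I. cinner x (f i))"
  unfolding cinner_def by (simp add: sum_distrib_left) (rule sum.swap)

lemma cinner_sum_left: "cinner (\<Sum>i\<in>I. f i) y = (\<Sum>i\<in>I. cinner (f i) y)"
  unfolding cinner_def by (simp add: sum_distrib_right) (rule sum.swap)

lemma cinner_scale_right: "cinner x (c *s y) = c * cinner x y"
  unfolding cinner_def by (simp add: sum_distrib_left mult_ac)

lemma cinner_scale_left: "cinner (c *s x) y = cnj c * cinner x y"
  unfolding cinner_def by (simp add: sum_distrib_left mult_ac)

lemma cinner_tensor: "cinner (x \<otimes>\<^sub>v y) (x' \<otimes>\<^sub>v y') = cinner x x' * cinner y y'"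
  unfolding cinner_def tensor_vec_def
  by (simp add: sum_product sum.cartesian_product case_prod_beta mult_ac flip: UNIV_Times_UNIV)

lemma cinner_zero_right [simp]: "cinner x 0 = 0"
  by (simp add: cinner_def)

lemma is_onbI:
  fixes e :: "'i \<Rightarrow> complex^'n"
  assumes fin: "finite I" and card: "card I = CARD('n)"
    and on: "\<And>i j. i \<in> I \<Longrightarrow> j \<in> I \<Longrightarrow> cinner (e i) (e j) = (if i = j then 1 else 0)"
  shows "is_onb I e"
proof -
  have inj: "inj_on e I"
    by (rule inj_onI) (metis on one_neq_zero)
  have ind: "vec.independent (e ` I)"
  proof (rule ccontr)
    assume "\<not> vec.independent (e ` I)"
    then obtain u v where u: "v \<in> e ` I" "u v \<noteq> 0" "(\<Sum>w\<in>e ` I. u w *s w) = 0"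
      using vec.dependent_finite[of "e ` I"] fin by auto
    then obtain i where i: "i \<in> I" "v = e i" by auto
    have "0 = cinner (e i) (\<Sum>k\<in>I. u (e k) *s e k)"
      using u(3) by (simp add: sum.reindex[OF inj])
    also have "\<dots> = (\<Sum>k\<in>I. if i = k then u (e k) else 0)"
      unfolding cinner_sum_right cinner_scale_right by (rule sum.cong) (use i on in auto)
    also have "\<dots> = u (e i)" using fin i by simp
    finally show False using u i by simp
  qed
  have "UNIV \<subseteq> vec.span (e ` I)"
  proof (rule vec.card_ge_dim_independent)
    have "vec.dim (UNIV :: (complex^'n) set) = CARD('n)" by (rule vec_dim_card)
    then show "vec.dim (UNIV :: (complex^'n) set) \<le> card (e ` I)"
      by (simp only: card_image[OF inj] card)
  qed (use ind in auto)
  then show ?thesis using on by (auto simp: is_onb_def)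
qed

lemma sum_roots_of_unity:
  fixes J I N :: nat
  assumes "J < N" "I < N"
  shows "(\<Sum>M<N. cis (2 * pi / real N * (real I - real J) * real M)) = (if I = J then of_nat N else 0)"
proof (cases "I = J")
  case False
  define r where "r = cis (2 * pi / real N * (real I - real J))"
  have N: "real N > 0" using assms by simp
  have "r \<noteq> 1"
  proof
    assume "r = 1"
    then have "cos (2 * pi / real N * (real I - real J)) = 1"
      by (simp add: r_def complex_eq_iff)
    then obtain n :: int where "2 * pi / real N * (real I - real J) = n * 2 * pi"
      using cos_one_2pi_int by auto
    then have "pi * (real I - real J) = pi * (n * real N)"
      using N by (simp add: field_simps)
    then have "real I - real J = n * real N" by simp
    then have *: "int I - int J = n * int N"
      by (metis of_int_eq_iff of_int_diff of_int_mult of_int_of_nat_eq)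
    have "\<bar>int I - int J\<bar> < int N" using assms by auto
    with * have "\<bar>n\<bar> * int N < 1 * int N" by (simp add: abs_mult)
    then have "n = 0" using assms by (simp only: mult_less_cancel_right) auto
    with * False show False by simp
  qed
  moreover have "r ^ N = 1"
  proof -
    have "real N * (2 * pi / real N * (real I - real J)) = 2 * pi * of_int (int I - int J)"
      using N by simp
    then have "r ^ N = cis (2 * pi * of_int (int I - int J))"
      by (simp only: r_def Complex.DeMoivre)
    also have "\<dots> = 1" by (rule cis_multiple_2pi) (rule Ints_of_int)
    finally show ?thesis .
  qed
  moreover have "(\<Sum>M<N. cis (2 * pi / real N * (real I - real J) * real M)) = (\<Sum>M<N. r ^ M)"
    by (simp add: r_def Complex.DeMoivre mult_ac)
  ultimately show ?thesis using False by (simp add: sum_gp_strict)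
qed (use assms in simp)

text \<open>The measurement kets form an orthonormal basis, so they define a von Neumann measurement.\<close>

lemma is_onb_measurement_ket:
  fixes e f :: "nat \<Rightarrow> complex^'d"
  assumes "is_onb {..<CARD('d)} e" "is_onb {..<CARD('d)} f"
  shows "is_onb ({..<CARD('d)} \<times> {..<CARD('d)}) (\<lambda>(j, j'). measurement_ket e f \<theta> j j')"
proof (rule is_onbI)
  define d where "d = CARD('d)"
  have d: "d > 0" by (simp add: d_def)
  define w where "w = (\<lambda>j j' m m'.
    cis (2 * pi / real (d\<^sup>2) * real (d * j + j') * real (d * m + m') + \<theta> m m'))"
  have e: "cinner (e m) (e k) = (if m = k then 1 else 0)"
    and f: "cinner (f m) (f k) = (if m = k then 1 else 0)" if "m < d" "k < d" for m k
    using assms that by (auto simp: is_onb_def d_def)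
  show "finite ({..<CARD('d)} \<times> {..<CARD('d)})" by simp
  show "card ({..<CARD('d)} \<times> {..<CARD('d)}) = CARD('d \<times> 'd)" by (simp add: card_cartesian_product)
  fix p q assume "p \<in> {..<CARD('d)} \<times> {..<CARD('d)}" "q \<in> {..<CARD('d)} \<times> {..<CARD('d)}"
  then obtain j j' i i' where pq: "p = (j, j')" "q = (i, i')"
    and lt: "j < d" "j' < d" "i < d" "i' < d" by (auto simp: d_def)
  have bound: "d * x + y < d\<^sup>2" if "x < d" "y < d" for x y
  proof -
    have "d * x + y < d * x + d" using that by simp
    also have "\<dots> = d * Suc x" by simp
    also have "\<dots> \<le> d * d" using that by (intro mult_le_mono2) simp
    finally show ?thesis by (simp add: power2_eq_square)
  qed
  define g where "g = (\<lambda>M. cis (2 * pi / real (d\<^sup>2) * (real (d * i + i') - real (d * j + j')) * real M))"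
  have key: "cinner (\<Sum>m<d. \<Sum>m'<d. w j j' m m' *s (e m \<otimes>\<^sub>v f m'))
                   (\<Sum>k<d. \<Sum>k'<d. w i i' k k' *s (e k \<otimes>\<^sub>v f k'))
             = (\<Sum>m<d. \<Sum>m'<d. g (m * d + m'))"
  proof -
    have "cinner (\<Sum>m<d. \<Sum>m'<d. w j j' m m' *s (e m \<otimes>\<^sub>v f m'))
                   (\<Sum>k<d. \<Sum>k'<d. w i i' k k' *s (e k \<otimes>\<^sub>v f k'))
        = (\<Sum>m<d. \<Sum>m'<d. \<Sum>k<d. \<Sum>k'<d.
            cnj (w j j' m m') * w i i' k k' * (cinner (e m) (e k) * cinner (f m') (f k')))"
      unfolding cinner_sum_left
      by (simp add: cinner_sum_right cinner_scale_left cinner_scale_right cinner_tensor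
          sum_distrib_left mult_ac)
    also have "\<dots> = (\<Sum>m<d. \<Sum>m'<d. \<Sum>k<d. \<Sum>k'<d.
            (if m = k then if m' = k' then cnj (w j j' m m') * w i i' k k' else 0 else 0))"
      by (intro sum.cong refl) (simp add: e f)
    also have "\<dots> = (\<Sum>m<d. \<Sum>m'<d. cnj (w j j' m m') * w i i' m m')"
    proof (intro sum.cong refl)
      fix m m' assume m: "m \<in> {..<d}" "m' \<in> {..<d}"
      have "(\<Sum>k<d. \<Sum>k'<d. (if m = k then if m' = k' then cnj (w j j' m m') * w i i' k k' else 0 else 0))
          = (\<Sum>k<d. if m = k then (\<Sum>k'<d. if m' = k' then cnj (w j j' m m') * w i i' k k' else 0) else 0)"
        by (intro sum.cong refl) auto
      then show "(\<Sum>k<d. \<Sum>k'<d. (if m = k then if m' = k' then cnj (w j j' m m') * w i i' k k' else 0 else 0))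
          = cnj (w j j' m m') * w i i' m m'"
        using m by simp
    qed
    also have "\<dots> = (\<Sum>m<d. \<Sum>m'<d. g (m * d + m'))"
      by (intro sum.cong refl) (simp add: w_def g_def cis_cnj cis_mult algebra_simps)
    finally show ?thesis .
  qed
  have "(\<Sum>m<d. \<Sum>m'<d. g (m * d + m')) = (\<Sum>m<d. sum g {m * d..<m * d + d})"
  proof (rule sum.cong[OF refl])
    fix m
    show "(\<Sum>m'<d. g (m * d + m')) = sum g {m * d..<m * d + d}"
      using sum.shift_bounds_nat_ivl[of g 0 "m * d" d] by (simp add: atLeast0LessThan add.commute)
  qed
  also have "\<dots> = sum g {..<d\<^sup>2}" by (simp add: sum.nat_group power2_eq_square)
  also have "\<dots> = (if d * i + i' = d * j + j' then of_nat (d\<^sup>2) else 0)"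
    unfolding g_def by (rule sum_roots_of_unity) (use bound lt in auto)
  also have "d * i + i' = d * j + j' \<longleftrightarrow> p = q"
  proof
    assume h: "d * i + i' = d * j + j'"
    have "(d * i + i') div d = i" "(d * j + j') div d = j" using lt d by auto
    with h show "p = q" by (simp add: pq)
  qed (simp add: pq)
  finally have "(\<Sum>m<d. \<Sum>m'<d. g (m * d + m')) = (if p = q then of_nat (d\<^sup>2) else 0)" .
  then show "cinner (case p of (j, j') \<Rightarrow> measurement_ket e f \<theta> j j')
      (case q of (j, j') \<Rightarrow> measurement_ket e f \<theta> j j') = (if p = q then 1 else 0)"
    using key d
    by (simp add: pq measurement_ket_def Let_def flip: d_def w_def)
       (auto simp: cinner_scale_left cinner_scale_right w_def power2_eq_square)
qed

end

theory Submission
  imports Defs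
begin

text \<open>
  Projecting systems 2 and 3 of a pure state \<open>V\<close> onto a unit vector \<open>P\<close> leaves \<open>P\<close> on systems 2 and 3
  and the partial inner product of \<open>P\<close> with \<open>V\<close> on systems 1 and 4. For \<open>V = \<psi> \<otimes> \<chi>\<close> and a measurement
  ket \<open>P\<close>, the coefficient of \<open>|kk'\<rangle>\<close> in this partial inner product is \<open>a\<^sub>k b\<^sub>k'\<close> times the conjugate
  phase of the ket divided by \<open>d\<close>. The local unitaries remove the \<open>(j, j')\<close>-dependent part of the
  phase, because \<open>(d j + j') d m / d\<^sup>2\<close> and \<open>j' m / d\<close> differ by the integer \<open>j m\<close>. All phases have
  modulus 1, so every outcome has probability \<open>1 / d\<^sup>2\<close> in each pure component and normalization
  multiplies all of them by the same factor \<open>d\<^sup>2\<close>.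
\<close>

definition partial_cinner_23 ::
    "complex^('b::finite \<times> 'c::finite) \<Rightarrow> complex^(('a::finite \<times> 'b) \<times> ('c \<times> 'd::finite))
     \<Rightarrow> complex^('a \<times> 'd)" where
  "partial_cinner_23 P V =
     (\<chi> r. \<Sum>i2\<in>UNIV. \<Sum>i3\<in>UNIV. cnj (P $ (i2, i3)) * V $ ((fst r, i2), (i3, snd r)))"

text \<open>This is the adjoint of \<open>partial_cinner_23 P\<close>: the product of
  \<open>P\<close> and \<open>C\<close> with its factors reordered to the grouping
  (1,2),(3,4).\<close>

definition insert_23 ::
    "complex^('b::finite \<times> 'c::finite) \<Rightarrow> complex^('a::finite \<times> 'd::finite)
     \<Rightarrow> complex^(('a \<times> 'b) \<times> ('c \<times> 'd))" where
  "insert_23 P C = (\<chi> r. P $ (snd (fst r), fst (snd r)) * C $ (fst (fst r), snd (snd r)))"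

section \<open>Rank-one operators, mixtures and tensor products\<close>

lemma sum_UNIV_Times:
  fixes g :: "'a::finite \<times> 'b::finite \<Rightarrow> 'c::comm_monoid_add"
  shows "sum g UNIV = (\<Sum>i\<in>UNIV. \<Sum>j\<in>UNIV. g (i, j))"
  by (simp add: sum.cartesian_product flip: UNIV_Times_UNIV)

lemma cinner_self: "cinner x x = of_real ((norm x)\<^sup>2)"
  by (simp add: cinner_def norm_vec_def L2_set_def sum_nonneg complex_norm_square mult.commute
      del: of_real_power)

lemma trace_ketbra: "trace (ketbra x y) = cinner y x"
  by (simp add: trace_def ketbra_def cinner_def mult.commute)

lemma ketbra_scale: "ketbra (c *s x) (c *s x) = (cmod c)\<^sup>2 *\<^sub>R ketbra x x"
  by (simp add: ketbra_def vec_eq_iff complex_norm_square scaleR_conv_of_real[where 'a = complex] mult_ac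
      del: of_real_power)

lemma matrix_vector_mult_sum: "A *v (\<Sum>i\<in>I. x i) = (\<Sum>i\<in>I. A *v (x i :: complex^'n))"
  by (simp add: vec_eq_iff matrix_vector_mult_def sum_distrib_left) (intro allI sum.swap)

lemma matrix_vector_mult_scale: "A *v (c *s x) = c *s (A *v (x :: complex^'n))"
  by (simp add: vec_eq_iff matrix_vector_mult_def sum_distrib_left mult_ac)

lemma sandwich_ketbra: "A ** ketbra x x ** dagger A = ketbra (A *v x) (A *v x)"
proof -
  have "A ** ketbra x x = ketbra (A *v x) x"
    by (simp add: vec_eq_iff matrix_matrix_mult_def matrix_vector_mult_def ketbra_def
        sum_distrib_right mult.assoc)
  moreover have "ketbra y x ** dagger A = ketbra y (A *v x)" for y :: "complex^'k"
    by (simp add: vec_eq_iff matrix_matrix_mult_def matrix_vector_mult_def ketbra_def dagger_def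
        sum_distrib_left mult_ac)
  ultimately show ?thesis by simp
qed

text \<open>Real linearity is enough here, since the weights of a mixture are real.\<close>

lemma linear_sandwich: "linear (\<lambda>M :: complex^'n^'n. A ** M ** B)"
  by (rule linearI)
    (simp_all add: vec_eq_iff matrix_matrix_mult_def algebra_simps sum.distrib
      sum_distrib_left sum_distrib_right scaleR_conv_of_real[where 'a = complex])

lemma linear_ptrace_23: "linear ptrace_23"
  by (rule linearI)
    (simp_all add: vec_eq_iff ptrace_23_def case_prod_beta sum.distrib scaleR_sum_right)

lemma linear_trace: "linear (trace :: complex^'n^'n \<Rightarrow> complex)"
  by (rule linearI) (simp_all add: trace_def sum.distrib scaleR_sum_right)

text \<open>Used twice: with the measurement projector as \<open>A\<close>, and with the local
  unitaries as \<open>A\<close>.\<close>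

lemma sandwich_mixture:
  "A ** (\<Sum>s\<in>S. c s *\<^sub>R ketbra (x s) (x s)) ** dagger A
    = (\<Sum>s\<in>S. c s *\<^sub>R ketbra (A *v x s) (A *v x s))"
  by (simp add: linear_sum[OF linear_sandwich] linear_scale[OF linear_sandwich] sandwich_ketbra)

lemma tensor_mat_mult_tensor_vec: "(A \<otimes>\<^sub>m B) *v (x \<otimes>\<^sub>v y) = (A *v x) \<otimes>\<^sub>v (B *v y)"
  unfolding vec_eq_iff matrix_vector_mult_def tensor_mat_def tensor_vec_def sum_product
    sum_UNIV_Times vec_lambda_beta fst_conv snd_conv
  by (simp add: mult_ac)

lemma tensor_mat_ketbra: "ketbra x x' \<otimes>\<^sub>m ketbra y y' = ketbra (x \<otimes>\<^sub>v y) (x' \<otimes>\<^sub>v y')"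
  by (simp add: vec_eq_iff ketbra_def tensor_mat_def tensor_vec_def mult_ac)

lemma tensor_vec_scale: "(c *s x) \<otimes>\<^sub>v (c' *s y) = (c * c') *s (x \<otimes>\<^sub>v y)"
  by (simp add: vec_eq_iff tensor_vec_def mult_ac)

lemma tensor_vec_sum:
  "(\<Sum>i\<in>I. x i) \<otimes>\<^sub>v (\<Sum>j\<in>J. y j) = (\<Sum>i\<in>I. \<Sum>j\<in>J. x i \<otimes>\<^sub>v y j)"
  by (simp add: vec_eq_iff tensor_vec_def sum_product)

text \<open>Flattens the two ensembles into one indexed by pairs, so that the lemmas on mixtures
  over a single index set apply.\<close>

lemma tensor_mat_mixture:
  "(\<Sum>i\<in>I. p i *\<^sub>R A i) \<otimes>\<^sub>m (\<Sum>j\<in>J. q j *\<^sub>R B j)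
    = (\<Sum>s\<in>I \<times> J. (p (fst s) * q (snd s)) *\<^sub>R (A (fst s) \<otimes>\<^sub>m B (snd s)))"
  by (simp add: vec_eq_iff tensor_mat_def sum_product sum.cartesian_product case_prod_beta
      mult_ac)

section \<open>The measurement on systems 2 and 3\<close>

text \<open>The projector factors as contraction with \<open>P\<close> followed by insertion of
  \<open>P\<close>. Everything that depends on the input state thus lives on systems 1 and
  4.\<close>

lemma on_23_ketbra: "on_23 (ketbra P P) *v V = insert_23 P (partial_cinner_23 P V)"
proof -
  have "(on_23 (ketbra P P) *v V) $ ((i1, i2), (i3, i4))
      = insert_23 P (partial_cinner_23 P V) $ ((i1, i2), (i3, i4))" for i1 i2 i3 i4
  proof -
    \<comment> \<open>The condition on \<open>j4\<close> is outermost because the sum over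
      \<open>j4\<close> is innermost and collapses first; the condition on \<open>j1\<close> can
      then leave the sums over \<open>j2\<close> and \<open>j3\<close>.\<close>
    have "(on_23 (ketbra P P) *v V) $ ((i1, i2), (i3, i4))
        = (\<Sum>j1\<in>UNIV. \<Sum>j2\<in>UNIV. \<Sum>j3\<in>UNIV. \<Sum>j4\<in>UNIV. if i4 = j4 then if i1 = j1
            then P $ (i2, i3) * cnj (P $ (j2, j3)) * V $ ((j1, j2), (j3, j4)) else 0 else 0)"
      unfolding matrix_vector_mult_def on_23_def ketbra_def sum_UNIV_Times vec_lambda_beta prod.case
      by (intro sum.cong refl) simp
    also have "\<dots> = (\<Sum>j1\<in>UNIV. if i1 = j1 then \<Sum>j2\<in>UNIV. \<Sum>j3\<in>UNIV.
            P $ (i2, i3) * cnj (P $ (j2, j3)) * V $ ((j1, j2), (j3, i4)) else 0)"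
      by (intro sum.cong refl) auto
    also have "\<dots> = insert_23 P (partial_cinner_23 P V) $ ((i1, i2), (i3, i4))"
      by (simp add: insert_23_def partial_cinner_23_def sum_distrib_left mult_ac)
    finally show ?thesis .
  qed
  then show ?thesis by (auto simp: vec_eq_iff)
qed

text \<open>Systems 2 and 3 are in a product with the rest, so tracing them out only contributes the
  factor \<open>cinner P P\<close>.\<close>

lemma ptrace_23_ketbra_insert_23:
  assumes "cinner P P = 1"
  shows "ptrace_23 (ketbra (insert_23 P C) (insert_23 P C)) = ketbra C C"
proof -
  have "ptrace_23 (ketbra (insert_23 P C) (insert_23 P C)) $ r $ s = cinner P P * ketbra C C $ r $ s"
    for r s
    unfolding ptrace_23_def ketbra_def insert_23_def cinner_def case_prod_beta sum_UNIV_Times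
      sum_distrib_right vec_lambda_beta fst_conv snd_conv
    by (simp add: mult_ac)
  then show ?thesis using assms by (simp add: vec_eq_iff)
qed

text \<open>Lets the outcome probability be computed on systems 1 and 4.\<close>

lemma trace_ptrace_23: "trace (ptrace_23 M) = trace M"
proof -
  have "trace (ptrace_23 M)
      = (\<Sum>i1\<in>UNIV. \<Sum>i4\<in>UNIV. \<Sum>i2\<in>UNIV. \<Sum>i3\<in>UNIV. M $ ((i1, i2), i3, i4) $ ((i1, i2), i3, i4))"
    by (simp add: trace_def ptrace_23_def sum_UNIV_Times)
  also have "\<dots> = (\<Sum>i1\<in>UNIV. \<Sum>i2\<in>UNIV. \<Sum>i4\<in>UNIV. \<Sum>i3\<in>UNIV. M $ ((i1, i2), i3, i4) $ ((i1, i2), i3, i4))"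
    by (intro sum.cong refl, rule sum.swap)
  also have "\<dots> = (\<Sum>i1\<in>UNIV. \<Sum>i2\<in>UNIV. \<Sum>i3\<in>UNIV. \<Sum>i4\<in>UNIV. M $ ((i1, i2), i3, i4) $ ((i1, i2), i3, i4))"
    by (intro sum.cong refl, rule sum.swap)
  also have "\<dots> = trace M" by (simp add: trace_def sum_UNIV_Times)
  finally show ?thesis .
qed

text \<open>Turns entrywise complex division into a real scaling, which commutes with linear maps.
  For \<open>t = 0\<close> both sides are zero.\<close>

lemma normalize_state_eq_scaleR:
  assumes "trace M = of_real t"
  shows "normalize_state M = (1 / t) *\<^sub>R M"
  using assms by (simp add: normalize_state_def vec_eq_iff scaleR_conv_of_real[where 'a = complex])

text \<open>Conditioning on an outcome normally reweights an ensemble by the probability of the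
  outcome in each component. Here that probability is the same \<open>t\<close> for all components,
  so the weights \<open>c\<close> survive.\<close>

lemma ptrace_23_post_measurement_mixture:
  assumes P: "cinner P P = 1"
    and V: "\<And>s. s \<in> S \<Longrightarrow> cinner (partial_cinner_23 P (V s)) (partial_cinner_23 P (V s)) = of_real t"
    and c: "sum c S = 1"
  shows "ptrace_23 (post_measurement P (\<Sum>s\<in>S. c s *\<^sub>R ketbra (V s) (V s)))
    = (1 / t) *\<^sub>R (\<Sum>s\<in>S. c s *\<^sub>R ketbra (partial_cinner_23 P (V s)) (partial_cinner_23 P (V s)))"
proof -
  define M where "M = (\<Sum>s\<in>S. c s *\<^sub>R ketbra (insert_23 P (partial_cinner_23 P (V s)))
    (insert_23 P (partial_cinner_23 P (V s))))"
  have M: "ptrace_23 M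
      = (\<Sum>s\<in>S. c s *\<^sub>R ketbra (partial_cinner_23 P (V s)) (partial_cinner_23 P (V s)))"
    by (simp add: M_def linear_sum[OF linear_ptrace_23] linear_scale[OF linear_ptrace_23]
        ptrace_23_ketbra_insert_23[OF P])
  have "trace M = (\<Sum>s\<in>S. c s *\<^sub>R of_real t)"
    by (simp add: M linear_sum[OF linear_trace] linear_scale[OF linear_trace]
        trace_ketbra V flip: trace_ptrace_23)
  then have "trace M = of_real t"
    by (simp add: c flip: scaleR_sum_left)
  then show ?thesis
    by (simp add: post_measurement_def sandwich_mixture on_23_ketbra normalize_state_eq_scaleR
        linear_scale[OF linear_ptrace_23] M flip: M_def)
qed

section \<open>Amplitudes in product bases, and phases\<close>

text \<open>Entanglement swapping on product vectors: the inner factors contract to a scalar and the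
  outer ones become the joint state.\<close>

lemma partial_cinner_23_tensor:
  "partial_cinner_23 P ((u \<otimes>\<^sub>v v) \<otimes>\<^sub>v (s \<otimes>\<^sub>v t)) = cinner P (v \<otimes>\<^sub>v s) *s (u \<otimes>\<^sub>v t)"
  by (simp add: vec_eq_iff partial_cinner_23_def cinner_def tensor_vec_def sum_UNIV_Times
      sum_distrib_left sum_distrib_right mult_ac)

lemma linear_partial_cinner_23: "linear (partial_cinner_23 P)"
  by (rule linearI)
    (simp_all add: vec_eq_iff partial_cinner_23_def algebra_simps sum.distrib scaleR_sum_right)

lemma partial_cinner_23_scale: "partial_cinner_23 P (c *s x) = c *s partial_cinner_23 P x"
  by (simp add: vec_eq_iff partial_cinner_23_def sum_distrib_left mult_ac)

lemma cinner_sum_onb_tensor: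
  fixes e :: "nat \<Rightarrow> complex^'m" and f :: "nat \<Rightarrow> complex^'n"
  assumes "is_onb {..<d} e" "is_onb {..<d} f" "k < d" "k' < d"
  shows "cinner (\<Sum>m<d. \<Sum>m'<d. c m m' *s (e m \<otimes>\<^sub>v f m')) (e k \<otimes>\<^sub>v f k') = cnj (c k k')"
proof -
  have "cinner (\<Sum>m<d. \<Sum>m'<d. c m m' *s (e m \<otimes>\<^sub>v f m')) (e k \<otimes>\<^sub>v f k')
      = (\<Sum>m<d. \<Sum>m'<d. if m = k then if m' = k' then cnj (c m m') else 0 else 0)"
    unfolding cinner_sum_left cinner_scale_left cinner_tensor
    using assms by (intro sum.cong refl) (simp add: is_onb_def)
  also have "\<dots> = (\<Sum>m<d. if m = k then \<Sum>m'<d. if m' = k' then cnj (c m m') else 0 else 0)"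
    by (intro sum.cong refl) simp
  also have "\<dots> = cnj (c k k')"
    using assms by (simp only: sum.delta finite_lessThan lessThan_iff if_True)
  finally show ?thesis .
qed

text \<open>Parseval in the product basis; it gives the outcome probability.\<close>

lemma cinner_sum_onb_tensor_self:
  fixes e :: "nat \<Rightarrow> complex^'m" and f :: "nat \<Rightarrow> complex^'n"
  assumes "is_onb {..<d} e" "is_onb {..<d} f"
  shows "cinner (\<Sum>m<d. \<Sum>m'<d. c m m' *s (e m \<otimes>\<^sub>v f m')) (\<Sum>m<d. \<Sum>m'<d. c m m' *s (e m \<otimes>\<^sub>v f m'))
    = of_real (\<Sum>m<d. \<Sum>m'<d. (cmod (c m m'))\<^sup>2)"
  using assms
  by (simp add: cinner_sum_right cinner_scale_right cinner_sum_onb_tensor complex_norm_square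
      del: of_real_power)

text \<open>Translates the normalization of \<open>psi\<close> and \<open>chi\<close> into a
  condition on their Schmidt amplitudes.\<close>

lemma norm_sq_schmidt:
  fixes e :: "nat \<Rightarrow> complex^'m" and f :: "nat \<Rightarrow> complex^'n"
  assumes e: "is_onb {..<d} e" and f: "is_onb {..<d} f"
  shows "(norm (\<Sum>k<d. c k *s (e k \<otimes>\<^sub>v f k)))\<^sup>2 = (\<Sum>k<d. (cmod (c k))\<^sup>2)"
proof -
  let ?x = "\<Sum>k<d. c k *s (e k \<otimes>\<^sub>v f k)"
  have "of_real ((norm ?x)\<^sup>2) = (\<Sum>m<d. \<Sum>k<d. cnj (c k) * c m * (cinner (e k) (e m) * cinner (f k) (f m)))"
    unfolding cinner_self[symmetric] cinner_sum_left cinner_sum_right cinner_scale_left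
      cinner_scale_right cinner_tensor sum_distrib_left
    by (simp add: mult_ac)
  also have "\<dots> = (\<Sum>m<d. \<Sum>k<d. if k = m then cnj (c k) * c m else 0)"
    using e f by (intro sum.cong refl) (auto simp: is_onb_def)
  also have "\<dots> = of_real (\<Sum>m<d. (cmod (c m))\<^sup>2)"
    by (simp add: complex_norm_square mult.commute del: of_real_power)
  finally show ?thesis by (simp only: of_real_eq_iff)
qed

lemma cis_phase_reduction:
  fixes d j j' m m' :: nat
  assumes "d > 0"
  shows "cis (- (2 * pi / real (d\<^sup>2) * real (d * j + j') * real (d * m + m') + t))
    * (cis (2 * pi / real d * real j' * real m)
       * cis (2 * pi / real (d\<^sup>2) * real (d * j + j') * real m')) = cis (- t)"
proof -
  \<comment> \<open>The phase of Alice cancels only the \<open>j'\<close> part of the term in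
    \<open>m\<close>. The \<open>j\<close> part is a whole number of turns, which is why her
    correction need not depend on \<open>j\<close>.\<close>
  have "- (2 * pi / real (d\<^sup>2) * real (d * j + j') * real (d * m + m') + t)
      + (2 * pi / real d * real j' * real m + 2 * pi / real (d\<^sup>2) * real (d * j + j') * real m')
      = - t + 2 * pi * (- of_nat (j * m))"
    using assms by (simp add: field_simps power2_eq_square)
  moreover have "cis (2 * pi * (- of_nat (j * m))) = 1"
    by (rule cis_multiple_2pi) simp
  ultimately show ?thesis by (simp only: cis_mult flip: cis_mult[of "- t"]) simp
qed

theorem mainTheorem5:
  fixes d n n' :: nat
    and e1 e2 e3 e4 :: "nat \<Rightarrow> complex^'d"
    and p q :: "nat \<Rightarrow> real"
    and a b :: "nat \<Rightarrow> nat \<Rightarrow> complex"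
    and psi chi :: "nat \<Rightarrow> complex^('d \<times> 'd)"
    and phi :: "nat \<Rightarrow> nat \<Rightarrow> complex^('d \<times> 'd)"
    and \<rho>12 \<rho>34 \<sigma>14 :: "complex^('d \<times> 'd)^('d \<times> 'd)"
    and \<theta> :: "nat \<Rightarrow> nat \<Rightarrow> real"
    and Ua :: "nat \<Rightarrow> complex^'d^'d"
    and Ub :: "nat \<Rightarrow> nat \<Rightarrow> complex^'d^'d"
  assumes "d = CARD('d)" and "d \<ge> 2" and "n \<le> d" and "n' \<le> d"
    and "is_onb {..<d} e1" and "is_onb {..<d} e2"
    and "is_onb {..<d} e3" and "is_onb {..<d} e4"
    and "\<And>l. l \<in> {1..n} \<Longrightarrow> p l \<ge> 0" and "(\<Sum>l=1..n. p l) = 1"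
    and "\<And>l'. l' \<in> {1..n'} \<Longrightarrow> q l' \<ge> 0" and "(\<Sum>l'=1..n'. q l') = 1"
    and "\<And>l. l \<in> {1..n} \<Longrightarrow> psi l = (\<Sum>k<d. a l k *s (e1 k \<otimes>\<^sub>v e2 k))"
    and "\<And>l'. l' \<in> {1..n'} \<Longrightarrow> chi l' = (\<Sum>k'<d. b l' k' *s (e3 k' \<otimes>\<^sub>v e4 k'))"
    and "\<And>l. l \<in> {1..n} \<Longrightarrow> norm (psi l) = 1"
    and "\<And>l'. l' \<in> {1..n'} \<Longrightarrow> norm (chi l') = 1"
    and "\<rho>12 = (\<Sum>l=1..n. p l *\<^sub>R ketbra (psi l) (psi l))"
    and "\<rho>34 = (\<Sum>l'=1..n'. q l' *\<^sub>R ketbra (chi l') (chi l'))"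
    and "\<And>j j' m'. j < d \<Longrightarrow> j' < d \<Longrightarrow> m' < d \<Longrightarrow>
           Ub j j' *v e4 m' = cis (2 * pi / real (d\<^sup>2) * real (d * j + j') * real m') *s e4 m'"
    and "\<And>j' m. j' < d \<Longrightarrow> m < d \<Longrightarrow>
           Ua j' *v e1 m = cis (2 * pi / real d * real j' * real m) *s e1 m"
    and "\<And>l l'. l \<in> {1..n} \<Longrightarrow> l' \<in> {1..n'} \<Longrightarrow>
           phi l l' = (\<Sum>k<d. \<Sum>k'<d. (a l k * b l' k' * cis (- \<theta> k k')) *s (e1 k \<otimes>\<^sub>v e4 k'))"
    and "\<sigma>14 = (\<Sum>l=1..n. \<Sum>l'=1..n'. (p l * q l') *\<^sub>R ketbra (phi l l') (phi l l'))"
  shows "\<forall>j<d. \<forall>j'<d.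
           apply_unitary (Ua j' \<otimes>\<^sub>m Ub j j')
             (ptrace_23 (post_measurement (measurement_ket e2 e3 \<theta> j j') (\<rho>12 \<otimes>\<^sub>m \<rho>34)))
           = \<sigma>14"
proof (intro allI impI)
  fix j j' assume j: "j < d" "j' < d"
  have d: "d > 0" using assms(2) by simp
  define w where "w m m' = cis (2 * pi / real (d\<^sup>2) * real (d * j + j') * real (d * m + m') + \<theta> m m')"
    for m m'
  define P where "P = measurement_ket e2 e3 \<theta> j j'"
  \<comment> \<open>The prefactor is absorbed into the coefficients, the form that
    \<open>cinner_sum_onb_tensor\<close> expects.\<close>
  have P: "P = (\<Sum>m<d. \<Sum>m'<d. (w m m' / of_nat d) *s (e2 m \<otimes>\<^sub>v e3 m'))"
    by (simp add: P_def measurement_ket_def Let_def w_def vec_eq_iff sum_distrib_left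
        flip: assms(1))
  have PP: "cinner P P = 1"
    using is_onb_measurement_ket[of e2 e3 \<theta>] assms(6,7) j by (simp add: is_onb_def P_def assms(1))
  \<comment> \<open>Amplitudes of the unnormalized state on systems 1 and 4; the conjugate arises
    because \<open>P\<close> is the left argument of \<open>cinner\<close>.\<close>
  define W where "W l l' k k' = a l k * b l' k' * cnj (w k k') / of_nat d" for l l' k k'
  let ?V = "\<lambda>s. psi (fst s) \<otimes>\<^sub>v chi (snd s)"
  let ?S = "{1..n} \<times> {1..n'}"
  have C: "partial_cinner_23 P (?V s) = (\<Sum>k<d. \<Sum>k'<d. W (fst s) (snd s) k k' *s (e1 k \<otimes>\<^sub>v e4 k'))"
    if "s \<in> ?S" for s
  proof -
    have "partial_cinner_23 P (?V s) = (\<Sum>k<d. \<Sum>k'<d.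
        (a (fst s) k * b (snd s) k') *s (cinner P (e2 k \<otimes>\<^sub>v e3 k') *s (e1 k \<otimes>\<^sub>v e4 k')))"
      using that by (simp add: mem_Times_iff assms(13,14) tensor_vec_sum tensor_vec_scale
          linear_sum[OF linear_partial_cinner_23] partial_cinner_23_scale partial_cinner_23_tensor)
    also have "\<dots> = (\<Sum>k<d. \<Sum>k'<d. W (fst s) (snd s) k k' *s (e1 k \<otimes>\<^sub>v e4 k'))"
      unfolding P by (intro sum.cong refl)
        (simp add: cinner_sum_onb_tensor[OF assms(6,7)] W_def)
    finally show ?thesis .
  qed
  have a: "(\<Sum>k<d. (cmod (a l k))\<^sup>2) = 1" if "l \<in> {1..n}" for l
    using norm_sq_schmidt[OF assms(5,6), of "a l"] assms(13)[OF that] assms(15)[OF that] by simp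
  have b: "(\<Sum>k<d. (cmod (b l k))\<^sup>2) = 1" if "l \<in> {1..n'}" for l
    using norm_sq_schmidt[OF assms(7,8), of "b l"] assms(14)[OF that] assms(16)[OF that] by simp
  have prob: "cinner (partial_cinner_23 P (?V s)) (partial_cinner_23 P (?V s)) = of_real (1 / (real d)\<^sup>2)"
    if s: "s \<in> ?S" for s
  proof -
    \<comment> \<open>The phases have modulus 1, so the double sum splits into the squared norms of
      the two input states.\<close>
    have "(\<Sum>k<d. \<Sum>k'<d. (cmod (W (fst s) (snd s) k k'))\<^sup>2)
        = (\<Sum>k<d. (cmod (a (fst s) k))\<^sup>2) * (\<Sum>k'<d. (cmod (b (snd s) k'))\<^sup>2) / (real d)\<^sup>2"
      by (simp add: W_def w_def norm_mult norm_divide power_mult_distrib power_divide sum_product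
          sum_divide_distrib)
    then show ?thesis
      using s a b by (simp only: C cinner_sum_onb_tensor_self[OF assms(5,8)]) (simp add: mem_Times_iff)
  qed
  have pq: "(\<Sum>s\<in>?S. p (fst s) * q (snd s)) = 1"
    using sum_product[of p "{1..n}" q "{1..n'}"] assms(10,12)
    by (simp add: sum.cartesian_product case_prod_beta)
  let ?U = "Ua j' \<otimes>\<^sub>m Ub j j'"
  \<comment> \<open>The corrections are followed on amplitudes, where they act on each basis product
    by a scalar.\<close>
  have U: "?U *v partial_cinner_23 P (?V s) = (1 / of_nat d) *s phi (fst s) (snd s)"
    if s: "s \<in> ?S" for s
  proof -
    let ?u = "\<lambda>k. cis (2 * pi / real d * real j' * real k)"
    let ?v = "\<lambda>k'. cis (2 * pi / real (d\<^sup>2) * real (d * j + j') * real k')"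
    have "?U *v partial_cinner_23 P (?V s)
        = (\<Sum>k<d. \<Sum>k'<d. W (fst s) (snd s) k k' *s ((?u k * ?v k') *s (e1 k \<otimes>\<^sub>v e4 k')))"
      unfolding C[OF s] matrix_vector_mult_sum matrix_vector_mult_scale tensor_mat_mult_tensor_vec
      using assms(19,20) j by (intro sum.cong refl) (simp only: lessThan_iff tensor_vec_scale)
    also have "\<dots> = (\<Sum>k<d. \<Sum>k'<d. (1 / of_nat d) *s
        ((a (fst s) k * b (snd s) k' * cis (- \<theta> k k')) *s (e1 k \<otimes>\<^sub>v e4 k')))"
    proof (intro sum.cong refl)
      fix k k'
      have "cnj (w k k') * (?u k * ?v k') = cis (- \<theta> k k')"
        unfolding w_def cis_cnj by (rule cis_phase_reduction[OF d])
      then have "W (fst s) (snd s) k k' * (?u k * ?v k')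
          = 1 / of_nat d * (a (fst s) k * b (snd s) k' * cis (- \<theta> k k'))"
        unfolding W_def by (simp add: mult.assoc)
      then show "W (fst s) (snd s) k k' *s ((?u k * ?v k') *s (e1 k \<otimes>\<^sub>v e4 k')) = (1 / of_nat d) *s
        ((a (fst s) k * b (snd s) k' * cis (- \<theta> k k')) *s (e1 k \<otimes>\<^sub>v e4 k'))"
        by (simp only: vector_smult_assoc)
    qed
    also have "\<dots> = (1 / of_nat d) *s phi (fst s) (snd s)"
      using s by (simp add: mem_Times_iff assms(21) vec_eq_iff sum_distrib_left)
    finally show ?thesis .
  qed
  \<comment> \<open>The factor is the inverse of the common probability from
    \<open>prob\<close>.\<close>
  have "ptrace_23 (post_measurement P (\<rho>12 \<otimes>\<^sub>m \<rho>34)) = (real d)\<^sup>2 *\<^sub>R (\<Sum>s\<in>?S. (p (fst s) * q (snd s)) *\<^sub>R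
      ketbra (partial_cinner_23 P (?V s)) (partial_cinner_23 P (?V s)))"
    using ptrace_23_post_measurement_mixture[OF PP prob pq]
    by (simp add: assms(17,18) tensor_mat_mixture tensor_mat_ketbra)
  then have "apply_unitary ?U (ptrace_23 (post_measurement P (\<rho>12 \<otimes>\<^sub>m \<rho>34)))
      = (real d)\<^sup>2 *\<^sub>R (\<Sum>s\<in>?S. (p (fst s) * q (snd s)) *\<^sub>R
          ketbra (?U *v partial_cinner_23 P (?V s)) (?U *v partial_cinner_23 P (?V s)))"
    by (simp add: apply_unitary_def linear_scale[OF linear_sandwich] sandwich_mixture)
  also have "\<dots> = (\<Sum>s\<in>?S. (p (fst s) * q (snd s)) *\<^sub>R ketbra (phi (fst s) (snd s)) (phi (fst s) (snd s)))"
    unfolding scaleR_sum_right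
  proof (intro sum.cong refl)
    fix s assume "s \<in> ?S"
    then show "(real d)\<^sup>2 *\<^sub>R (p (fst s) * q (snd s)) *\<^sub>R
          ketbra (?U *v partial_cinner_23 P (?V s)) (?U *v partial_cinner_23 P (?V s))
        = (p (fst s) * q (snd s)) *\<^sub>R ketbra (phi (fst s) (snd s)) (phi (fst s) (snd s))"
      \<comment> \<open>The amplitude factor \<open>1 / d\<close> enters the projector squared and
        cancels the normalization factor.\<close>
      using d by (simp only: U ketbra_scale) (simp add: norm_divide power_divide)
  qed
  also have "\<dots> = \<sigma>14"
    by (simp add: assms(22) sum.cartesian_product case_prod_beta)
  finally show "apply_unitary ?U
      (ptrace_23 (post_measurement (measurement_ket e2 e3 \<theta> j j') (\<rho>12 \<otimes>\<^sub>m \<rho>34))) = \<sigma>14"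
    by (simp only: P_def)
qed

end
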